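(* Let $\alpha$ be a subset of $\{1,2,3,4,5,6\}$ and, for each $i\in\alpha$, let $\mathcal{P}_i\in\{A_i,B_i\}$ and $\mathcal{Q}_i\in\{C_i,D_i\}$. Then for every integer $n\ge 1$, $$s_n\bigl(\{\mathcal{P}_i: i\in\alpha\}\cup\{\mathcal{Q}_i:i\in\alpha\}\bigr)=2\,s_n\bigl(\{A_i:i\in\alpha\}\bigr).$$
   Context: A standard piece is a $2\times 2$ matrix whose four entries are $1,2,3,4$, each occurring exactly once. For $n\ge 1$, a standard $n$-puzzle is a $2\times(n+1)$ matrix whose entries are $1,2,\dots,2n+2$, each occurring exactly once; its pieces are its $n$ submatrices formed by two consecutive columns. The reduction of a piece is the standard piece obtained by replacing its four distinct entries by $1,2,3,4$ in an order-preserving way. A set $\mathcal{P}$ of standard pieces is a support of a puzzle if the reduction of each piece of the puzzle lies in $\mathcal{P}$. $S_n(\mathcal{P})$ is the set of standard $n$-puzzles having $\mathcal{P}$ as a support, and $s_n(\mathcal{P})=|S_n(\mathcal{P})|$. The 24 standard pieces are: $A_1=\left[\begin{smallmatrix}4&3\\1&2\end{smallmatrix}\right]$, $A_2=\left[\begin{smallmatrix}3&4\\1&2\end{smallmatrix}\right]$, $A_3=\left[\begin{smallmatrix}2&4\\1&3\end{smallmatrix}\right]$, $A_4=\left[\begin{smallmatrix}3&4\\2&1\end{smallmatrix}\right]$, $A_5=\left[\begin{smallmatrix}4&3\\2&1\end{smallmatrix}\right]$, $A_6=\left[\begin{smallmatrix}4&2\\3&1\end{smallmatrix}\right]$; $B_1=\left[\begin{smallmatrix}4&2\\1&3\end{smallmatrix}\right]$,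 $B_2=\left[\begin{smallmatrix}3&2\\1&4\end{smallmatrix}\right]$, $B_3=\left[\begin{smallmatrix}2&3\\1&4\end{smallmatrix}\right]$, $B_4=\left[\begin{smallmatrix}3&1\\2&4\end{smallmatrix}\right]$, $B_5=\left[\begin{smallmatrix}4&1\\2&3\end{smallmatrix}\right]$, $B_6=\left[\begin{smallmatrix}4&1\\3&2\end{smallmatrix}\right]$; $C_i$ and $D_i$ are obtained from $B_i$ and $A_i$ respectively by exchanging the top and bottom rows, $1\le i\le 6$. *)

theory Defs
  imports "Jordan_Normal_Form.Gauss_Jordan_Elimination"
begin

text \<open>Matrices are indexed from 0: row 0 is the top row and row 1 the bottom row.\<close>

definition standard_pieces :: "nat mat set" where
  "standard_pieces =
     {X \<in> carrier_mat 2 2. bij_betw (\<lambda>ij. X $$ ij) ({..<2} \<times> {..<2}) {1..4}}"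

definition standard_puzzles :: "nat \<Rightarrow> nat mat set" where
  "standard_puzzles n =
     {M \<in> carrier_mat 2 (n + 1).
        bij_betw (\<lambda>ij. M $$ ij) ({..<2} \<times> {..<n + 1}) {1..2 * n + 2}}"

text \<open>The submatrix formed by the columns \<open>k\<close> and \<open>k + 1\<close>.\<close>

definition column_pair :: "nat \<Rightarrow> 'a mat \<Rightarrow> 'a mat" where
  "column_pair k M = mat 2 2 (\<lambda>(i, j). M $$ (i, k + j))"

definition pieces :: "nat \<Rightarrow> 'a mat \<Rightarrow> 'a mat set" where
  "pieces n M = {column_pair k M |k. k < n}"

text \<open>Every entry is replaced by its rank, counted from 1, among the entries. By
  \<open>reduction_standard\<close> and \<open>reduction_less_iff\<close> below, this is the
  order-preserving replacement of four distinct entries by \<open>1, 2, 3, 4\<close>.\<close>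

definition reduction :: "nat mat \<Rightarrow> nat mat" where
  "reduction X = map_mat (\<lambda>x. card {y \<in> elements_mat X. y \<le> x}) X"

definition is_support :: "nat mat set \<Rightarrow> nat \<Rightarrow> nat mat \<Rightarrow> bool" where
  "is_support P n M \<longleftrightarrow> (\<forall>X \<in> pieces n M. reduction X \<in> P)"

definition supported_puzzles :: "nat \<Rightarrow> nat mat set \<Rightarrow> nat mat set" where
  "supported_puzzles n P = {M \<in> standard_puzzles n. is_support P n M}"

definition num_supported_puzzles :: "nat \<Rightarrow> nat mat set \<Rightarrow> nat" where
  "num_supported_puzzles n P = card (supported_puzzles n P)"

text \<open>The four families are meaningful for indices in \<open>{1..6}\<close> only.\<close>

definition piece_A :: "nat \<Rightarrow> nat mat" where
  "piece_A i = mat_of_rows_list 2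
     ([[[4, 3], [1, 2]],
       [[3, 4], [1, 2]],
       [[2, 4], [1, 3]],
       [[3, 4], [2, 1]],
       [[4, 3], [2, 1]],
       [[4, 2], [3, 1]]] ! (i - 1))"

definition piece_B :: "nat \<Rightarrow> nat mat" where
  "piece_B i = mat_of_rows_list 2
     ([[[4, 2], [1, 3]],
       [[3, 2], [1, 4]],
       [[2, 3], [1, 4]],
       [[3, 1], [2, 4]],
       [[4, 1], [2, 3]],
       [[4, 1], [3, 2]]] ! (i - 1))"

definition piece_C :: "nat \<Rightarrow> nat mat" where
  "piece_C i = swaprows 0 1 (piece_B i)"

definition piece_D :: "nat \<Rightarrow> nat mat" where
  "piece_D i = swaprows 0 1 (piece_A i)"

lemma rank_less_iff:
  fixes x y :: nat
  assumes "finite E" "x \<in> E" "y \<in> E"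
  shows "card {z \<in> E. z \<le> x} < card {z \<in> E. z \<le> y} \<longleftrightarrow> x < y"
proof
  assume "x < y"
  then have "{z \<in> E. z \<le> x} \<subset> {z \<in> E. z \<le> y}"
    using assms by force
  then show "card {z \<in> E. z \<le> x} < card {z \<in> E. z \<le> y}"
    using assms(1) by (intro psubset_card_mono) auto
next
  assume less: "card {z \<in> E. z \<le> x} < card {z \<in> E. z \<le> y}"
  show "x < y"
  proof (rule ccontr)
    assume "\<not> x < y"
    then have "{z \<in> E. z \<le> y} \<subseteq> {z \<in> E. z \<le> x}" by auto
    then have "card {z \<in> E. z \<le> y} \<le> card {z \<in> E. z \<le> x}"
      using assms(1) by (intro card_mono) auto
    then show False using less by simp
  qed
qed

lemma elements_mat_image:
  assumes "X \<in> carrier_mat nr nc"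
  shows "elements_mat X = (\<lambda>ij. X $$ ij) ` ({..<nr} \<times> {..<nc})"
proof (rule Set.set_eqI, rule iffI)
  fix a assume "a \<in> elements_mat X"
  then obtain i j where "i < dim_row X" "j < dim_col X" "a = X $$ (i, j)"
    using elements_matD by blast
  then show "a \<in> (\<lambda>ij. X $$ ij) ` ({..<nr} \<times> {..<nc})"
    using assms by (intro image_eqI[where x = "(i, j)"]) simp_all
next
  fix a assume "a \<in> (\<lambda>ij. X $$ ij) ` ({..<nr} \<times> {..<nc})"
  then obtain i j where "i < nr" "j < nc" "a = X $$ (i, j)" by blast
  then show "a \<in> elements_mat X" using elements_matI[OF assms] by blast
qed

lemma reduction_less_iff:
  assumes "X \<in> carrier_mat 2 2" "p \<in> {..<2} \<times> {..<2}" "q \<in> {..<2} \<times> {..<2}"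
  shows "reduction X $$ p < reduction X $$ q \<longleftrightarrow> X $$ p < X $$ q"
proof -
  have "finite (elements_mat X)" "X $$ p \<in> elements_mat X" "X $$ q \<in> elements_mat X"
    using assms by (auto simp: elements_mat_image[OF assms(1)])
  from rank_less_iff[OF this] show ?thesis
    using assms by (auto simp: reduction_def)
qed

lemma reduction_standard:
  assumes X: "X \<in> carrier_mat 2 2"
    and inj: "inj_on (\<lambda>ij. X $$ ij) ({..<2} \<times> {..<2})"
  shows "reduction X \<in> standard_pieces"
proof -
  let ?I = "{..<2::nat} \<times> {..<2::nat}"
  let ?E = "elements_mat X"
  have E: "?E = (\<lambda>ij. X $$ ij) ` ?I" by (rule elements_mat_image[OF X])
  have fin: "finite ?E" and cE: "card ?E = 4"
    using card_image[OF inj] by (auto simp: E)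
  have inj': "inj_on (\<lambda>ij. reduction X $$ ij) ?I"
  proof (rule inj_onI)
    fix p q assume p: "p \<in> ?I" and q: "q \<in> ?I" and eq: "reduction X $$ p = reduction X $$ q"
    have "X $$ p = X $$ q"
      using reduction_less_iff[OF X p q] reduction_less_iff[OF X q p] eq
      by linarith
    then show "p = q" by (rule inj_onD[OF inj _ p q])
  qed
  have range: "(\<lambda>ij. reduction X $$ ij) ` ?I \<subseteq> {1..4}"
  proof
    fix r assume "r \<in> (\<lambda>ij. reduction X $$ ij) ` ?I"
    then obtain p where p: "p \<in> ?I" and r: "r = reduction X $$ p" by auto
    have red: "r = card {y \<in> ?E. y \<le> X $$ p}"
      using p X r by (auto simp: reduction_def)
    have "X $$ p \<in> {y \<in> ?E. y \<le> X $$ p}" using p by (auto simp: E)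
    moreover have "finite {y \<in> ?E. y \<le> X $$ p}" using fin by simp
    ultimately have "0 < r" unfolding red by (subst card_gt_0_iff) blast
    then have "1 \<le> r" by simp
    moreover have "r \<le> 4" unfolding red cE[symmetric] by (rule card_mono[OF fin]) auto
    ultimately show "r \<in> {1..4}" by simp
  qed
  have "(\<lambda>ij. reduction X $$ ij) ` ?I = {1..4}"
    by (rule card_subset_eq[OF _ range]) (auto simp: card_image[OF inj'])
  then show ?thesis using inj' X
    by (auto simp: standard_pieces_def bij_betw_def reduction_def)
qed

lemma finite_supported_puzzles: "finite (supported_puzzles n P)"
proof (rule finite_subset)
  let ?I = "{..<2::nat} \<times> {..<n + 1}"
  let ?F = "PiE ?I (\<lambda>_. {1..2 * n + 2})"
  show "supported_puzzles n P \<subseteq> mat 2 (n + 1) ` ?F"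
  proof
    fix M assume "M \<in> supported_puzzles n P"
    then have M: "M \<in> carrier_mat 2 (n + 1)" and
      b: "bij_betw (\<lambda>ij. M $$ ij) ?I {1..2 * n + 2}"
      by (auto simp: supported_puzzles_def standard_puzzles_def)
    have "M = mat 2 (n + 1) (restrict (\<lambda>ij. M $$ ij) ?I)"
      using M by (intro eq_matI) auto
    moreover have "restrict (\<lambda>ij. M $$ ij) ?I \<in> ?F"
      using bij_betw_imp_funcset[OF b] by auto
    ultimately show "M \<in> mat 2 (n + 1) ` ?F" by (rule image_eqI)
  qed
  show "finite (mat 2 (n + 1) ` ?F)" by (intro finite_imageI finite_PiE) auto
qed

lemma mat_of_rows_list_standard:
  assumes "{a, b, c, d} = {1, 2, 3, 4 :: nat}"
  shows "mat_of_rows_list 2 [[a, b], [c, d]] \<in> standard_pieces"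
proof -
  let ?X = "mat_of_rows_list 2 [[a, b], [c, d]]"
  have I: "{..<2::nat} \<times> {..<2::nat} = {(0, 0), (0, 1), (1, 0), (1, 1)}" by auto
  have J: "{1..4} = {1, 2, 3, 4 :: nat}" by auto
  have im: "(\<lambda>ij. ?X $$ ij) ` ({..<2} \<times> {..<2}) = {1..4}"
    unfolding I J assms[symmetric] by (simp add: mat_of_rows_list_def)
  have "inj_on (\<lambda>ij. ?X $$ ij) ({..<2} \<times> {..<2})"
    by (rule eq_card_imp_inj_on) (simp_all only: im, simp_all)
  moreover have "?X \<in> carrier_mat 2 2"
    by (simp add: mat_of_rows_list_def numeral_2_eq_2)
  ultimately show ?thesis
    using im by (simp add: standard_pieces_def bij_betw_def)
qed

lemma swaprows_mat_of_rows_list: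
  "swaprows 0 1 (mat_of_rows_list 2 [[a, b], [c, d]]) = mat_of_rows_list 2 [[c, d], [a, b]]"
  by (rule eq_matI) (auto simp: mat_of_rows_list_def mat_swaprows_def less_Suc_eq numeral_2_eq_2)

lemma standard_piece_listed:
  assumes "i \<in> {1..6}"
  shows "{piece_A i, piece_B i, piece_C i, piece_D i} \<subseteq> standard_pieces"
proof -
  have "i = 1 \<or> i = 2 \<or> i = 3 \<or> i = 4 \<or> i = 5 \<or> i = 6" using assms by auto
  then show ?thesis
    by (elim disjE)
      (simp_all add: piece_A_def piece_B_def piece_C_def piece_D_def
        swaprows_mat_of_rows_list[simplified] mat_of_rows_list_standard insert_commute)
qed

end

theory Submission
  imports Defs
begin

text \<open>
  \<open>B\<^sub>i\<close>, \<open>C\<^sub>i\<close> and \<open>D\<^sub>i\<close> arise from \<open>A\<^sub>i\<close> by exchanging the two entries of the second, of the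
  first, and of both columns, while the \<open>A\<^sub>i\<close> themselves have decreasing columns. So a puzzle is
  the same thing as a puzzle with decreasing columns together with the set of columns that are flipped.
  Choosing \<open>P\<^sub>i\<close> says whether the column after an unflipped one is flipped, choosing \<open>Q\<^sub>i\<close> says the
  same for the column after a flipped one. Hence over each puzzle with support \<open>{A\<^sub>i}\<close> the
  state of the first column is free and determines the states of all others.
\<close>

section \<open>Flipping columns of a two-row matrix\<close>

definition flip_cols :: "(nat \<Rightarrow> bool) \<Rightarrow> 'a mat \<Rightarrow> 'a mat" where
  "flip_cols f M = mat 2 (dim_col M) (\<lambda>(i, j). M $$ (if f j then 1 - i else i, j))"

definition decreasing_cols :: "'a::linorder mat \<Rightarrow> bool" where
  "decreasing_cols M \<longleftrightarrow> (\<forall>j < dim_col M. M $$ (1, j) < M $$ (0, j))"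

text \<open>A piece has only columns 0 and 1, so the value \<open>c\<close> that
  \<open>case_nat\<close> repeats at all later indices matters at index 1 only.\<close>

abbreviation flip_pair :: "bool \<Rightarrow> bool \<Rightarrow> 'a mat \<Rightarrow> 'a mat" where
  "flip_pair b c \<equiv> flip_cols (case_nat b (\<lambda>_. c))"

lemma dim_flip_cols [simp]:
  "dim_row (flip_cols f M) = 2" "dim_col (flip_cols f M) = dim_col M"
  by (simp_all add: flip_cols_def)

lemma flip_cols_carrier: "M \<in> carrier_mat nr nc \<Longrightarrow> flip_cols f M \<in> carrier_mat 2 nc"
  by (auto simp: flip_cols_def)

lemma index_flip_cols [simp]:
  "i < 2 \<Longrightarrow> j < dim_col M \<Longrightarrow> flip_cols f M $$ (i, j) = M $$ (if f j then 1 - i else i, j)"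
  by (simp add: flip_cols_def)

lemma flip_cols_flip_cols:
  "dim_row M = 2 \<Longrightarrow> flip_cols f (flip_cols f M) = M"
  by (rule eq_matI) (auto simp: flip_cols_def)

lemma flip_cols_cong:
  "(\<And>j. j < dim_col M \<Longrightarrow> f j = g j) \<Longrightarrow> flip_cols f M = flip_cols g M"
  by (rule eq_matI) (auto simp: flip_cols_def)

lemma flip_cols_less_iff:
  assumes "decreasing_cols M" "j < dim_col M"
  shows "flip_cols f M $$ (0, j) < flip_cols f M $$ (1, j) \<longleftrightarrow> f j"
  using assms by (auto simp: decreasing_cols_def not_less intro: less_imp_le)

text \<open>Since the unflipped columns decrease, the order of the two entries in a column of the
  common matrix reveals its state. So \<open>f\<close> and \<open>g\<close> agree on the columns,
  and flipping once more recovers both matrices.\<close>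

lemma flip_cols_eq_imp_eq:
  assumes "flip_cols f M = flip_cols g N" "decreasing_cols M" "decreasing_cols N"
    and "dim_row M = 2" "dim_row N = 2"
  shows "M = N" and "j < dim_col M \<Longrightarrow> f j = g j"
proof -
  have d: "dim_col M = dim_col N" using arg_cong[OF assms(1), of dim_col] by simp
  have fg: "f j = g j" if "j < dim_col M" for j
    using that flip_cols_less_iff[OF assms(2), of j f] flip_cols_less_iff[OF assms(3), of j g]
    by (simp add: d assms(1))
  then show "j < dim_col M \<Longrightarrow> f j = g j" .
  have "flip_cols f M = flip_cols f N"
    using assms(1) fg d by (metis flip_cols_cong)
  then show "M = N" using assms(4,5) by (metis flip_cols_flip_cols)
qed

section \<open>Flipping compared with pieces, reduction and standard puzzles\<close>

lemma column_pair_carrier [simp]: "column_pair k M \<in> carrier_mat 2 2"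
  by (simp add: column_pair_def)

lemma column_pair_flip_cols:
  assumes "M \<in> carrier_mat 2 (n + 1)" "k < n"
  shows "column_pair k (flip_cols f M) = flip_pair (f k) (f (Suc k)) (column_pair k M)"
  using assms by (intro eq_matI) (auto simp: column_pair_def less_2_cases_iff)

text \<open>One inclusion, shown for every two-row matrix, suffices: applied to
  \<open>flip_cols f M\<close> it gives the other one, because flipping is an involution.\<close>

lemma elements_mat_flip_cols:
  assumes "M \<in> carrier_mat 2 nc"
  shows "elements_mat (flip_cols f M) = elements_mat M"
proof -
  have sub: "elements_mat (flip_cols f N) \<subseteq> elements_mat N" if "N \<in> carrier_mat 2 nc" for N
  proof
    fix a assume "a \<in> elements_mat (flip_cols f N)"
    then obtain i j where "i < dim_row (flip_cols f N)" "j < dim_col (flip_cols f N)"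
      "a = flip_cols f N $$ (i, j)"
      using elements_matD by blast
    then have "a = N $$ (if f j then 1 - i else i, j)" "(if f j then 1 - i else i) < 2" "j < nc"
      using that by auto
    then show "a \<in> elements_mat N" using elements_matI[OF that] by blast
  qed
  have "flip_cols f (flip_cols f M) = M"
    by (rule flip_cols_flip_cols[OF carrier_matD(1)[OF assms]])
  then show ?thesis using sub[OF assms] sub[OF flip_cols_carrier[OF assms, of f]] by auto
qed

text \<open>The rank of an entry depends only on the set of entries, which flipping
  preserves.\<close>

lemma reduction_flip_cols:
  assumes "X \<in> carrier_mat 2 2"
  shows "reduction (flip_cols f X) = flip_cols f (reduction X)"
  using assms
  by (intro eq_matI) (auto simp: reduction_def elements_mat_flip_cols)

lemma reduction_piece_flip_cols:
  assumes "M \<in> carrier_mat 2 (n + 1)" "k < n"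
  shows "reduction (column_pair k (flip_cols f M)) =
    flip_pair (f k) (f (Suc k)) (reduction (column_pair k M))"
  by (simp add: column_pair_flip_cols[OF assms] reduction_flip_cols)

lemma decreasing_cols_reduction:
  assumes "X \<in> carrier_mat 2 2"
  shows "decreasing_cols (reduction X) \<longleftrightarrow> decreasing_cols X"
  using assms reduction_less_iff[OF assms, of "(1, 0)" "(0, 0)"]
    reduction_less_iff[OF assms, of "(1, 1)" "(0, 1)"]
  by (auto simp: decreasing_cols_def reduction_def less_2_cases_iff)

lemma decreasing_cols_column_pair:
  assumes "M \<in> carrier_mat 2 (n + 1)" "n \<ge> 1"
  shows "decreasing_cols M \<longleftrightarrow> (\<forall>k < n. decreasing_cols (column_pair k M))"
proof
  assume "decreasing_cols M"
  then show "\<forall>k < n. decreasing_cols (column_pair k M)"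
    using assms by (auto simp: decreasing_cols_def column_pair_def)
next
  assume *: "\<forall>k < n. decreasing_cols (column_pair k M)"
  have "M $$ (1, j) < M $$ (0, j)" if j: "j \<le> n" for j
  proof (cases "j < n")
    case True
    then show ?thesis using *[rule_format, of j] by (force simp: decreasing_cols_def column_pair_def)
  next
    case False
    \<comment> \<open>The last column starts no pair. It is the second column of the pair at
      \<open>m\<close>, which exists because \<open>n \<ge> 1\<close>.\<close>
    then obtain m where "n = Suc m" "j = Suc m" using j assms(2) by (cases n) auto
    then show ?thesis using *[rule_format, of m]
      by (simp add: decreasing_cols_def column_pair_def numeral_2_eq_2 All_less_Suc)
  qed
  then show "decreasing_cols M" using assms by (auto simp: decreasing_cols_def)
qed

text \<open>Flipping reads the entries through an involution \<open>?h\<close> of the index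
  set.\<close>

lemma flip_cols_standard_puzzles:
  assumes "M \<in> standard_puzzles n"
  shows "flip_cols f M \<in> standard_puzzles n"
proof -
  let ?I = "{..<2::nat} \<times> {..<n + 1}"
  let ?h = "\<lambda>(i, j). (if f j then 1 - i else i :: nat, j)"
  have M: "M \<in> carrier_mat 2 (n + 1)" and b: "bij_betw (\<lambda>ij. M $$ ij) ?I {1..2 * n + 2}"
    using assms by (auto simp: standard_puzzles_def)
  have "bij_betw ?h ?I ?I"
    by (rule bij_betwI[where g = ?h]) (auto split: if_splits)
  from bij_betw_trans[OF this b]
  have "bij_betw (\<lambda>ij. flip_cols f M $$ ij) ?I {1..2 * n + 2}"
    by (rule bij_betw_cong[THEN iffD1, rotated]) (use M in auto)
  then show ?thesis using M by (auto simp: standard_puzzles_def flip_cols_def)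
qed

lemma supported_puzzlesD:
  assumes "M \<in> supported_puzzles n P"
  shows "M \<in> standard_puzzles n" "M \<in> carrier_mat 2 (n + 1)"
    "k < n \<Longrightarrow> reduction (column_pair k M) \<in> P"
  using assms
  by (auto simp: supported_puzzles_def standard_puzzles_def is_support_def pieces_def)

lemma supported_puzzlesI:
  assumes "M \<in> standard_puzzles n" "\<And>k. k < n \<Longrightarrow> reduction (column_pair k M) \<in> P"
  shows "M \<in> supported_puzzles n P"
  using assms by (auto simp: supported_puzzles_def is_support_def pieces_def)

section \<open>Counting puzzles by the state of the first column\<close>

text \<open>The flip states of the columns of \<open>N\<close>, propagated from the state \<open>b\<close> of column 0 so that
  all pieces of the flipped puzzle reduce to elements of \<open>R\<close>.\<close>

fun flip_states :: "nat mat set \<Rightarrow> nat mat \<Rightarrow> bool \<Rightarrow> nat \<Rightarrow> bool" where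
  "flip_states R N b 0 = b"
| "flip_states R N b (Suc k) =
     (THE c. flip_pair (flip_states R N b k) c (reduction (column_pair k N)) \<in> R)"

text \<open>The bijection \<open>?F\<close> sends a first state and an \<open>\<A>\<close>-puzzle to
  a flipped puzzle. The assumption \<open>next_state\<close> makes the propagation of states well
  defined and unique; \<open>R\<close> ensures that every \<open>R\<close>-puzzle is
  reached.\<close>

theorem num_supported_puzzles_flip:
  assumes carrier: "\<A> \<subseteq> carrier_mat 2 2"
    and decr: "\<And>X. X \<in> \<A> \<Longrightarrow> decreasing_cols X"
    and next_state: "\<And>X b. X \<in> \<A> \<Longrightarrow> \<exists>!c. flip_pair b c X \<in> R"
    and R: "\<And>Y. Y \<in> R \<Longrightarrow> \<exists>X \<in> \<A>. \<exists>b c. Y = flip_pair b c X"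
    and n: "n \<ge> 1"
  shows "num_supported_puzzles n R = 2 * num_supported_puzzles n \<A>"
proof -
  let ?F = "\<lambda>(b, N). flip_cols (flip_states R N b) N"
  have decr_puzzle: "decreasing_cols N" if "N \<in> supported_puzzles n \<A>" for N
    unfolding decreasing_cols_column_pair[OF supported_puzzlesD(2)[OF that] n]
    using supported_puzzlesD(3)[OF that]
    by (intro allI impI, subst decreasing_cols_reduction[symmetric]) (auto intro: decr)
  have "bij_betw ?F (UNIV \<times> supported_puzzles n \<A>) (supported_puzzles n R)"
    unfolding bij_betw_def
  proof (intro conjI subset_antisym subsetI)
    show "inj_on ?F (UNIV \<times> supported_puzzles n \<A>)"
    proof (rule inj_onI, clarify)
      fix b N b' N'
      assume N: "N \<in> supported_puzzles n \<A>" and N': "N' \<in> supported_puzzles n \<A>"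
        and eq: "flip_cols (flip_states R N b) N = flip_cols (flip_states R N' b') N'"
      have dims: "dim_row N = 2" "dim_row N' = 2" "0 < dim_col N"
        using supported_puzzlesD(2)[OF N] supported_puzzlesD(2)[OF N'] by auto
      note * = flip_cols_eq_imp_eq[OF eq decr_puzzle[OF N] decr_puzzle[OF N'] dims(1,2)]
      from *(1) *(2)[OF dims(3)] show "b = b' \<and> N = N'" by simp
    qed
  next
    fix M assume "M \<in> ?F ` (UNIV \<times> supported_puzzles n \<A>)"
    then obtain b N where N: "N \<in> supported_puzzles n \<A>"
      and M: "M = flip_cols (flip_states R N b) N" by auto
    show "M \<in> supported_puzzles n R"
      unfolding M
    proof (rule supported_puzzlesI)
      show "flip_cols (flip_states R N b) N \<in> standard_puzzles n"
        by (rule flip_cols_standard_puzzles[OF supported_puzzlesD(1)[OF N]])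
      fix k assume k: "k < n"
      \<comment> \<open>By \<open>next_state\<close> the description in \<open>flip_states\<close>
        denotes a state that puts the flipped piece into \<open>R\<close>.\<close>
      from theI'[OF next_state[OF supported_puzzlesD(3)[OF N k]]]
      show "reduction (column_pair k (flip_cols (flip_states R N b) N)) \<in> R"
        by (simp only: reduction_piece_flip_cols[OF supported_puzzlesD(2)[OF N] k] flip_states.simps)
    qed
  next
    fix M assume M: "M \<in> supported_puzzles n R"
    note M_carrier = supported_puzzlesD(2)[OF M]
    \<comment> \<open>\<open>f\<close> marks the columns whose top entry is the smaller one;
      flipping exactly these recovers the candidate preimage \<open>N\<close>.\<close>
    define f where "f j \<longleftrightarrow> M $$ (0, j) < M $$ (1, j)" for j
    define N where "N = flip_cols f M"
    have N_standard: "N \<in> standard_puzzles n"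
      unfolding N_def by (rule flip_cols_standard_puzzles[OF supported_puzzlesD(1)[OF M]])
    have N_carrier: "N \<in> carrier_mat 2 (n + 1)"
      unfolding N_def by (rule flip_cols_carrier[OF M_carrier])
    have MN: "M = flip_cols f N" using M_carrier by (simp add: N_def flip_cols_flip_cols)
    have M_piece: "reduction (column_pair k M) =
        flip_pair (f k) (f (Suc k)) (reduction (column_pair k N))" if "k < n" for k
      unfolding MN by (rule reduction_piece_flip_cols[OF N_carrier that])
    have N_pieces: "reduction (column_pair k N) \<in> \<A>" if k: "k < n" for k
    proof -
      obtain X b c where X: "X \<in> \<A>" and eq: "reduction (column_pair k M) = flip_pair b c X"
        using R[OF supported_puzzlesD(3)[OF M k]] by blast
      have dims: "dim_row X = 2" "dim_col X = 2" using X carrier by auto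
      \<comment> \<open>Reduction preserves comparisons and \<open>X\<close> has decreasing columns,
        so the states \<open>b\<close> and \<open>c\<close> of this piece are the ones recorded by
        \<open>f\<close>.\<close>
      have less: "f (k + j) \<longleftrightarrow> case_nat b (\<lambda>_. c) j" if "j < 2" for j
      proof -
        have "f (k + j) \<longleftrightarrow> column_pair k M $$ (0, j) < column_pair k M $$ (1, j)"
          using that k by (simp add: f_def column_pair_def)
        also have "\<dots> \<longleftrightarrow> flip_pair b c X $$ (0, j) < flip_pair b c X $$ (1, j)"
          using that by (subst reduction_less_iff[symmetric]) (simp_all flip: eq)
        also have "\<dots> \<longleftrightarrow> case_nat b (\<lambda>_. c) j"
          by (rule flip_cols_less_iff[OF decr[OF X]]) (simp add: dims that)
        finally show ?thesis .
      qed
      have "reduction (column_pair k N) = flip_pair b c (reduction (column_pair k M))"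
        using less[of 0] less[of 1]
        by (simp add: N_def reduction_piece_flip_cols[OF M_carrier k])
      also have "\<dots> = X" unfolding eq by (rule flip_cols_flip_cols[OF dims(1)])
      finally show ?thesis using X by simp
    qed
    \<comment> \<open>Going from left to right, each piece of \<open>M\<close> lies in
      \<open>R\<close>, so uniqueness in \<open>next_state\<close> leaves only the propagated state
      for its second column.\<close>
    have states: "f j = flip_states R N (f 0) j" if "j \<le> n" for j
      using that
    proof (induction j)
      case (Suc k)
      then have k: "k < n" by simp
      have "flip_pair (f k) (f (Suc k)) (reduction (column_pair k N)) \<in> R"
        using supported_puzzlesD(3)[OF M k] M_piece[OF k] by simp
      note the_next = the1_equality[OF next_state[OF N_pieces[OF k]] this]
      have IH: "flip_states R N (f 0) k = f k" using Suc by simp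
      show ?case by (simp only: flip_states.simps IH the_next)
    qed simp
    have "M = flip_cols (flip_states R N (f 0)) N"
      by (rule trans[OF MN flip_cols_cong]) (rule states, use N_carrier in simp)
    moreover have "N \<in> supported_puzzles n \<A>"
      by (rule supported_puzzlesI[OF N_standard N_pieces])
    ultimately show "M \<in> ?F ` (UNIV \<times> supported_puzzles n \<A>)"
      by (intro image_eqI[where x = "(f 0, N)"]) auto
  qed
  \<comment> \<open>The factor 2 is the number of Boolean first states.\<close>
  from bij_betw_same_card[OF this] show ?thesis
    by (simp add: num_supported_puzzles_def card_cartesian_product)
qed

section \<open>The 24 standard pieces as flips of the six \<open>piece_A i\<close>\<close>

lemma index_1_to_6:
  fixes i :: nat
  assumes "i \<in> {1..6}"
  shows "i = 1 \<or> i = 2 \<or> i = 3 \<or> i = 4 \<or> i = 5 \<or> i = 6"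
  using assms by auto

lemma piece_A_carrier: "i \<in> {1..6} \<Longrightarrow> piece_A i \<in> carrier_mat 2 2"
  using standard_piece_listed by (auto simp: standard_pieces_def)

lemma decreasing_cols_piece_A: "i \<in> {1..6} \<Longrightarrow> decreasing_cols (piece_A i)"
  by (drule index_1_to_6, elim disjE)
    (auto simp: decreasing_cols_def piece_A_def mat_of_rows_list_def less_2_cases_iff)

lemma inj_on_piece_A: "inj_on piece_A {1..6}"
proof (rule inj_onI)
  fix i j :: nat
  assume ij: "i \<in> {1..6}" "j \<in> {1..6}" and eq: "piece_A i = piece_A j"
  have "piece_A i $$ (r, c) = piece_A j $$ (r, c)" for r c by (simp add: eq)
  \<comment> \<open>Three entries of a standard piece determine the fourth, so comparing these three
    positions is enough.\<close>
  from this[of 0 0] this[of 0 1] this[of 1 0] show "i = j"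
    using index_1_to_6[OF ij(1)] index_1_to_6[OF ij(2)]
    by (elim disjE) (simp_all add: piece_A_def mat_of_rows_list_def)
qed

lemma flip_pair_mat_of_rows_list:
  "flip_pair b e (mat_of_rows_list 2 [[p, q], [r, s]]) =
    mat_of_rows_list 2 [[if b then r else p, if e then s else q], [if b then p else r, if e then q else s]]"
  by (rule eq_matI) (auto simp: mat_of_rows_list_def less_2_cases_iff numeral_2_eq_2[symmetric])

text \<open>The first equation is turned around because \<open>piece_A i\<close> occurs on both
  sides: as a rewrite rule in the other direction it would loop.\<close>

lemma pieces_eq_flip_pair:
  assumes "i \<in> {1..6}"
  shows "flip_pair False False (piece_A i) = piece_A i"
    and "piece_B i = flip_pair False True (piece_A i)"
    and "piece_C i = flip_pair True False (piece_A i)"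
    and "piece_D i = flip_pair True True (piece_A i)"
  by (insert index_1_to_6[OF assms])
    (elim disjE; simp add: piece_A_def piece_B_def piece_C_def piece_D_def
      swaprows_mat_of_rows_list[simplified] flip_pair_mat_of_rows_list)+

lemma flip_pair_piece_A_eq_iff:
  assumes "i \<in> {1..6}" "j \<in> {1..6}"
  shows "flip_pair b c (piece_A i) = flip_pair b' c' (piece_A j) \<longleftrightarrow> i = j \<and> b = b' \<and> c = c'"
proof
  assume eq: "flip_pair b c (piece_A i) = flip_pair b' c' (piece_A j)"
  have dims: "dim_row (piece_A i) = 2" "dim_row (piece_A j) = 2" "dim_col (piece_A i) = 2"
    "dim_col (piece_A j) = 2"
    using piece_A_carrier[OF assms(1)] piece_A_carrier[OF assms(2)] by auto
  note * = flip_cols_eq_imp_eq[OF eq decreasing_cols_piece_A[OF assms(1)]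
      decreasing_cols_piece_A[OF assms(2)] dims(1,2)]
  from *(1) *(2)[of 0] *(2)[of 1] show "i = j \<and> b = b' \<and> c = c'"
    using inj_onD[OF inj_on_piece_A _ assms] by (simp add: dims)
qed simp

theorem theorem5p1:
  fixes \<alpha> :: "nat set" and P Q :: "nat \<Rightarrow> nat mat" and n :: nat
  assumes "\<alpha> \<subseteq> {1..6}"
    and "\<And>i. i \<in> \<alpha> \<Longrightarrow> P i \<in> {piece_A i, piece_B i}"
    and "\<And>i. i \<in> \<alpha> \<Longrightarrow> Q i \<in> {piece_C i, piece_D i}"
    and "n \<ge> 1"
  shows "num_supported_puzzles n ({P i |i. i \<in> \<alpha>} \<union> {Q i |i. i \<in> \<alpha>})
       = 2 * num_supported_puzzles n {piece_A i |i. i \<in> \<alpha>}"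
proof -
  have range: "i \<in> {1..6}" if "i \<in> \<alpha>" for i using that assms(1) by blast
  \<comment> \<open>\<open>p i\<close> is the state forced on the second column when the first is
    unflipped, and \<open>q i\<close> below the one forced when it is flipped.\<close>
  define p where "p i \<longleftrightarrow> P i = piece_B i" for i
  have p: "P i = flip_pair False (p i) (piece_A i)" if "i \<in> \<alpha>" for i
    using assms(2)[OF that]
    by (cases "P i = piece_B i") (simp_all add: p_def pieces_eq_flip_pair[OF range[OF that]])
  define q where "q i \<longleftrightarrow> Q i = piece_D i" for i
  have q: "Q i = flip_pair True (q i) (piece_A i)" if "i \<in> \<alpha>" for i
    using assms(3)[OF that]
    by (cases "Q i = piece_D i") (simp_all add: q_def pieces_eq_flip_pair[OF range[OF that]])
  \<comment> \<open>The flips of the \<open>piece_A i\<close> are pairwise distinct. So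
    \<open>b\<close> decides between the families \<open>P\<close> and \<open>Q\<close>, and the
    index \<open>i\<close> then fixes \<open>c\<close>, which yields
    \<open>next_state\<close>.\<close>
  have mem: "flip_pair b c (piece_A i) \<in> {P i |i. i \<in> \<alpha>} \<union> {Q i |i. i \<in> \<alpha>}
      \<longleftrightarrow> c = (if b then q i else p i)" if "i \<in> \<alpha>" for b c i
  proof -
    have *: "flip_pair b c (piece_A i) = P j \<longleftrightarrow> i = j \<and> \<not> b \<and> c = p j"
      "flip_pair b c (piece_A i) = Q j \<longleftrightarrow> i = j \<and> b \<and> c = q j" if "j \<in> \<alpha>" for j
      using that \<open>i \<in> \<alpha>\<close> by (simp_all add: p q flip_pair_piece_A_eq_iff[OF range range])
    have "flip_pair b c (piece_A i) \<in> {P i |i. i \<in> \<alpha>} \<union> {Q i |i. i \<in> \<alpha>} \<longleftrightarrow>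
        (\<exists>j \<in> \<alpha>. flip_pair b c (piece_A i) = P j) \<or> (\<exists>j \<in> \<alpha>. flip_pair b c (piece_A i) = Q j)"
      by blast
    also have "\<dots> \<longleftrightarrow> (\<exists>j \<in> \<alpha>. i = j \<and> \<not> b \<and> c = p j) \<or> (\<exists>j \<in> \<alpha>. i = j \<and> b \<and> c = q j)"
      by (simp add: * cong: bex_cong)
    also have "\<dots> \<longleftrightarrow> c = (if b then q i else p i)" using that by auto
    finally show ?thesis .
  qed
  show ?thesis
  proof (rule num_supported_puzzles_flip)
    show "{piece_A i |i. i \<in> \<alpha>} \<subseteq> carrier_mat 2 2"
      using piece_A_carrier range by blast
    show "decreasing_cols X" if "X \<in> {piece_A i |i. i \<in> \<alpha>}" for X
      using that decreasing_cols_piece_A range by blast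
    show "\<exists>!c. flip_pair b c X \<in> {P i |i. i \<in> \<alpha>} \<union> {Q i |i. i \<in> \<alpha>}"
      if mem_A: "X \<in> {piece_A i |i. i \<in> \<alpha>}" for X b
    proof -
      obtain i where i: "i \<in> \<alpha>" and X: "X = piece_A i" using mem_A by blast
      show ?thesis unfolding X mem[OF i] by simp
    qed
    show "\<exists>X \<in> {piece_A i |i. i \<in> \<alpha>}. \<exists>b c. Y = flip_pair b c X"
      if mem_PQ: "Y \<in> {P i |i. i \<in> \<alpha>} \<union> {Q i |i. i \<in> \<alpha>}" for Y
    proof -
      obtain i where i: "i \<in> \<alpha>" and "Y = P i \<or> Y = Q i" using mem_PQ by blast
      then have "Y = flip_pair False (p i) (piece_A i) \<or> Y = flip_pair True (q i) (piece_A i)"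
        by (simp only: p[OF i] q[OF i])
      moreover have "piece_A i \<in> {piece_A i |i. i \<in> \<alpha>}" using i by blast
      ultimately show ?thesis by blast
    qed
  qed (rule assms(4))
qed

end
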